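(* Let $M^5\subset\mathbb{C}^3$ be a connected real hypersurface belonging to the General Class $\mathsf{IV}_1$, of smoothness $\mathcal{C}^\kappa$ with $\kappa\geqslant 3$, or $\mathcal{C}^\infty$, or $\mathcal{C}^\omega$, with its biholomorphically invariant $(1,0)$ CR bundle $T^{1,0}M\subset\mathbb{C}\otimes_{\mathbb{R}}TM$. For any choice of an admissible pair $\{\mathcal{L}_1,\mathcal{L}_2\}$ of local vector field generators for $T^{1,0}M$, the associated frame $$\big\{\mathcal{L}_1,\ \mathcal{L}_2,\ \overline{\mathcal{L}}_1,\ \overline{\mathcal{L}}_2,\ \mathcal{T}\big\},\qquad \mathcal{T}:=\sqrt{-1}\,[\mathcal{L}_1,\overline{\mathcal{L}}_1],$$ for $\mathbb{C}\otimes_{\mathbb{R}}TM$ performs a reduction of the full $\mathsf{GL}_5(\mathbb{C})$-structure of $\mathbb{C}\otimes_{\mathbb{R}}TM$ to the subgroup of real dimension $13$ $$\mathsf{G}_{\mathsf{IV}_1}^{\mathsf{initial}}:=\left\{\begin{pmatrix}\mathsf{a}_{11}&\mathsf{a}_{21}&0&0&0\\ \mathsf{a}_{12}&\mathsf{a}_{22}&0&0&0\\0&0&\overline{\mathsf{a}}_{11}&\overline{\mathsf{a}}_{21}&0\\0&0&\overline{\mathsf{a}}_{12}&\overline{\mathsf{a}}_{22}&0\\ \mathsf{b}_1&\mathsf{b}_2&\overline{\mathsf{b}}_1&\overline{\mathsf{b}}_2&\mathsf{c}\end{pmatrix}:\ \mathsf{c}\in\mathbb{R}\setminus\{0\},\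 \mathsf{a}_{ij},\mathsf{b}_1,\mathsf{b}_2\in\mathbb{C},\ \mathsf{a}_{11}\mathsf{a}_{22}-\mathsf{a}_{12}\mathsf{a}_{21}\neq0\right\}\subset\mathsf{GL}_5(\mathbb{C}).$$
   Context: For a real hypersurface $M^5\subset\mathbb{C}^3$, $T^{1,0}M\subset\mathbb{C}\otimes_{\mathbb{R}}TM$ is the complex rank-$2$ bundle of $(1,0)$ vectors tangent to $M$, and $T^{0,1}M=\overline{T^{1,0}M}$. A pair of local generators $\{\mathcal{L}_1,\mathcal{L}_2\}$ is a local frame of $T^{1,0}M$, of the natural smoothness of the bundle ($\mathcal{C}^{\kappa-1}$, resp. $\mathcal{C}^\infty$, $\mathcal{C}^\omega$). The pair is called admissible if $\{\mathcal{L}_1,\mathcal{L}_2,\overline{\mathcal{L}}_1,\overline{\mathcal{L}}_2,\sqrt{-1}[\mathcal{L}_1,\overline{\mathcal{L}}_1]\}$ is a local frame of $\mathbb{C}\otimes_{\mathbb{R}}TM$. General Class $\mathsf{IV}_1$: $M^5\subset\mathbb{C}^3$ belongs to it if near each point some local frame of $T^{1,0}M$ becomes admissible after a possible constant $\mathsf{GL}_2(\mathbb{C})$ change of frame, and the Levi form of $M$ is nondegenerate (of rank $2$) at every point. "The frames perform a reduction of the full $\mathsf{GL}$-structure to a subgroup $\mathsf{G}$" means: $\mathsf{G}$ is a closed subgroup of the general linear group, and for any two admissible pairs of local generators defined on a common open subset $V\subset M$, the two associated frames, written as column vectors, are related at each point of $V$ by left multiplication by a matrix belonging to $\mathsf{G}$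 (with entries functions on $V$). *)

theory Defs
  imports "HOL-Analysis.Analysis" "HOL-Algebra.Group"
begin

datatype smoothness = C_fin nat | C_infinity | C_omega

primrec Ck_on :: "nat \<Rightarrow> 'a::euclidean_space set \<Rightarrow> ('a \<Rightarrow> 'b::real_normed_vector) \<Rightarrow> bool" where
  "Ck_on 0 U f \<longleftrightarrow> continuous_on U f"
| "Ck_on (Suc k) U f \<longleftrightarrow>
     (\<forall>x\<in>U. f differentiable (at x)) \<and>
     (\<forall>v. Ck_on k U (\<lambda>x. frechet_derivative f (at x) v))"

text \<open>Unordered summability of the multivariate power series. A multi-index is a function
  on the basis, extended by \<open>0\<close>.\<close>

definition power_series_near ::
  "'a::euclidean_space \<Rightarrow> ('a \<Rightarrow> 'b::real_normed_vector) \<Rightarrow> bool" where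
  "power_series_near p f \<longleftrightarrow>
     (\<exists>r>0. \<exists>c. \<forall>x\<in>ball p r.
        ((\<lambda>\<alpha>. (\<Prod>b\<in>Basis. ((x - p) \<bullet> b) ^ \<alpha> b) *\<^sub>R c \<alpha>) has_sum f x)
          {\<alpha> :: 'a \<Rightarrow> nat. \<forall>b. b \<notin> Basis \<longrightarrow> \<alpha> b = 0})"

fun of_class_on ::
  "smoothness \<Rightarrow> 'a::euclidean_space set \<Rightarrow> ('a \<Rightarrow> 'b::real_normed_vector) \<Rightarrow> bool" where
  "of_class_on (C_fin k) U f \<longleftrightarrow> Ck_on k U f"
| "of_class_on C_infinity U f \<longleftrightarrow> (\<forall>k. Ck_on k U f)"
| "of_class_on C_omega U f \<longleftrightarrow> (\<forall>k. Ck_on k U f) \<and> (\<forall>p\<in>U. power_series_near p f)"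

text \<open>\<open>of_class_on\<close> is meant for open subsets of the ambient space; on a (relatively open subset
  of a) submanifold, being of a given class means having local extensions of that class.\<close>

definition of_class_on_sub ::
  "smoothness \<Rightarrow> 'a::euclidean_space set \<Rightarrow> ('a \<Rightarrow> 'b::real_normed_vector) \<Rightarrow> bool" where
  "of_class_on_sub s V f \<longleftrightarrow>
     (\<forall>p\<in>V. \<exists>U F. open U \<and> p \<in> U \<and> of_class_on s U F \<and> (\<forall>x\<in>U \<inter> V. F x = f x))"

text \<open>The smoothness of the tangent bundle of a submanifold of class \<open>s\<close>.\<close>

fun bundle_class :: "smoothness \<Rightarrow> smoothness" where
  "bundle_class (C_fin k) = C_fin (k - 1)"
| "bundle_class C_infinity = C_infinity"
| "bundle_class C_omega = C_omega"

definition embedded_submanifold ::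
  "smoothness \<Rightarrow> nat \<Rightarrow> 'a::euclidean_space set \<Rightarrow> bool" where
  "embedded_submanifold s d S \<longleftrightarrow>
     (\<forall>p\<in>S. \<exists>U U' \<phi> \<psi> (W :: 'a set).
        open U \<and> p \<in> U \<and> open U' \<and> homeomorphism U U' \<phi> \<psi> \<and>
        of_class_on s U \<phi> \<and> of_class_on s U' \<psi> \<and>
        subspace W \<and> dim W = d \<and> \<phi> ` (U \<inter> S) = U' \<inter> W)"

definition real_hypersurface :: "smoothness \<Rightarrow> (complex^3) set \<Rightarrow> bool" where
  "real_hypersurface s M \<longleftrightarrow> embedded_submanifold s 5 M"

definition tangent_space :: "'a::real_normed_vector set \<Rightarrow> 'a \<Rightarrow> 'a set" where
  "tangent_space M p =
     {v. \<exists>\<gamma>. \<gamma> 0 = p \<and> (\<forall>t. \<gamma> t \<in> M) \<and> (\<gamma> has_vector_derivative v) (at (0::real))}"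

text \<open>The complexified tangent space of \<open>\<complex>\<^sup>3 = \<real>\<^sup>6\<close>, with \<open>z\<^sub>j = x\<^sub>j + \<i> y\<^sub>j\<close>: the component at
  \<open>Inl j\<close> is the coefficient of \<open>\<partial>/\<partial>x\<^sub>j\<close>, the one at \<open>Inr j\<close> the coefficient of \<open>\<partial>/\<partial>y\<^sub>j\<close>.
  Complex multiplication is \<open>*s\<close>, and every \<open>X\<close> is \<open>re_part X + \<i> im_part X\<close> with two real
  vectors in \<open>\<complex>\<^sup>3\<close>.\<close>

type_synonym ctvec = "complex ^ (3 + 3)"

definition re_part :: "ctvec \<Rightarrow> complex^3" where
  "re_part X = (\<chi> j. Complex (Re (X $ Inl j)) (Re (X $ Inr j)))"

definition im_part :: "ctvec \<Rightarrow> complex^3" where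
  "im_part X = (\<chi> j. Complex (Im (X $ Inl j)) (Im (X $ Inr j)))"

definition conj_vec :: "ctvec \<Rightarrow> ctvec" where
  "conj_vec X = (\<chi> k. cnj (X $ k))"

definition CT :: "(complex^3) set \<Rightarrow> complex^3 \<Rightarrow> ctvec set" where
  "CT M p = {X. re_part X \<in> tangent_space M p \<and> im_part X \<in> tangent_space M p}"

text \<open>The complex structure: \<open>J (\<partial>/\<partial>x\<^sub>j) = \<partial>/\<partial>y\<^sub>j\<close> and \<open>J (\<partial>/\<partial>y\<^sub>j) = - \<partial>/\<partial>x\<^sub>j\<close>. The vectors of
  type \<open>(1,0)\<close> are the combinations of the \<open>\<partial>/\<partial>z\<^sub>j = (\<partial>/\<partial>x\<^sub>j - \<i> \<partial>/\<partial>y\<^sub>j) / 2\<close>, i.e. the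
  eigenvectors of \<open>J\<close> for \<open>\<i>\<close>.\<close>

definition J_op :: "ctvec \<Rightarrow> ctvec" where
  "J_op X = (\<chi> k. case k of Inl j \<Rightarrow> - X $ Inr j | Inr j \<Rightarrow> X $ Inl j)"

definition T10 :: "(complex^3) set \<Rightarrow> complex^3 \<Rightarrow> ctvec set" where
  "T10 M p = {X \<in> CT M p. J_op X = \<i> *s X}"

definition T01 :: "(complex^3) set \<Rightarrow> complex^3 \<Rightarrow> ctvec set" where
  "T01 M p = conj_vec ` T10 M p"

text \<open>A derivative within \<open>M\<close> is only determined on \<open>tangent_space M p\<close>, so \<open>derive_along M X f p\<close>
  is meaningful for \<open>X \<in> CT M p\<close>.\<close>

definition derive_along ::
  "(complex^3) set \<Rightarrow> ctvec \<Rightarrow> (complex^3 \<Rightarrow> complex) \<Rightarrow> complex^3 \<Rightarrow> complex" where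
  "derive_along M X f p =
     frechet_derivative f (at p within M) (re_part X) +
     \<i> * frechet_derivative f (at p within M) (im_part X)"

definition lie_bracket ::
  "(complex^3) set \<Rightarrow> (complex^3 \<Rightarrow> ctvec) \<Rightarrow> (complex^3 \<Rightarrow> ctvec) \<Rightarrow> complex^3 \<Rightarrow> ctvec" where
  "lie_bracket M X Y p =
     (\<chi> k. derive_along M (X p) (\<lambda>q. Y q $ k) p - derive_along M (Y p) (\<lambda>q. X q $ k) p)"

text \<open>A frame is a column vector of vectors, i.e. a matrix whose rows are the frame vectors.\<close>

definition is_basis :: "ctvec^'n \<Rightarrow> ctvec set \<Rightarrow> bool" where
  "is_basis F W \<longleftrightarrow>
     inj (\<lambda>i. F $ i) \<and> vec.independent (range (\<lambda>i. F $ i)) \<and> vec.span (range (\<lambda>i. F $ i)) = W"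

definition local_generators ::
  "smoothness \<Rightarrow> (complex^3) set \<Rightarrow> (complex^3) set \<Rightarrow> (complex^3 \<Rightarrow> ctvec^2) \<Rightarrow> bool" where
  "local_generators s M V L \<longleftrightarrow>
     openin (top_of_set M) V \<and> of_class_on_sub (bundle_class s) V L \<and>
     (\<forall>p\<in>V. is_basis (L p) (T10 M p))"

definition assoc_frame ::
  "(complex^3) set \<Rightarrow> (complex^3 \<Rightarrow> ctvec^2) \<Rightarrow> complex^3 \<Rightarrow> ctvec^5" where
  "assoc_frame M L p =
     vector [L p $ 1, L p $ 2, conj_vec (L p $ 1), conj_vec (L p $ 2),
             \<i> *s lie_bracket M (\<lambda>q. L q $ 1) (\<lambda>q. conj_vec (L q $ 1)) p]"

definition admissible ::
  "smoothness \<Rightarrow> (complex^3) set \<Rightarrow> (complex^3) set \<Rightarrow> (complex^3 \<Rightarrow> ctvec^2) \<Rightarrow> bool" where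
  "admissible s M V L \<longleftrightarrow>
     local_generators s M V L \<and> (\<forall>p\<in>V. is_basis (assoc_frame M L p) (CT M p))"

definition local_section10 ::
  "smoothness \<Rightarrow> (complex^3) set \<Rightarrow> (complex^3) set \<Rightarrow> (complex^3 \<Rightarrow> ctvec) \<Rightarrow> bool" where
  "local_section10 s M V X \<longleftrightarrow>
     openin (top_of_set M) V \<and> of_class_on_sub (bundle_class s) V X \<and> (\<forall>q\<in>V. X q \<in> T10 M q)"

definition T10_plus_T01 :: "(complex^3) set \<Rightarrow> complex^3 \<Rightarrow> ctvec set" where
  "T10_plus_T01 M p = {X + Y | X Y. X \<in> T10 M p \<and> Y \<in> T01 M p}"

text \<open>The Levi form \<open>(X\<^sub>p, Y\<^sub>p) \<mapsto> \<i> [X, Y\<^sup>c]\<^sub>p\<close> modulo \<open>T10 + T01\<close>, where \<open>Y\<^sup>c\<close> is the conjugate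
  of \<open>Y\<close>; its value is the coset, as a set of vectors. The coset does not depend on the choice of
  the local sections \<open>X\<close> and \<open>Y\<close>.\<close>

definition levi_form ::
  "smoothness \<Rightarrow> (complex^3) set \<Rightarrow> complex^3 \<Rightarrow> ctvec \<Rightarrow> ctvec \<Rightarrow> ctvec set" where
  "levi_form s M p v w =
     {\<i> *s lie_bracket M X (\<lambda>q. conj_vec (Y q)) p + u | X Y V u.
        p \<in> V \<and> local_section10 s M V X \<and> local_section10 s M V Y \<and>
        X p = v \<and> Y p = w \<and> u \<in> T10_plus_T01 M p}"

definition levi_nondegenerate :: "smoothness \<Rightarrow> (complex^3) set \<Rightarrow> complex^3 \<Rightarrow> bool" where
  "levi_nondegenerate s M p \<longleftrightarrow>
     (\<forall>v\<in>T10 M p. (\<forall>w\<in>T10 M p. levi_form s M p v w = T10_plus_T01 M p) \<longrightarrow> v = 0)"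

definition class_IV_1 :: "smoothness \<Rightarrow> (complex^3) set \<Rightarrow> bool" where
  "class_IV_1 s M \<longleftrightarrow>
     (\<forall>p\<in>M. \<exists>V L (A :: complex^2^2).
        p \<in> V \<and> local_generators s M V L \<and> invertible A \<and> admissible s M V (\<lambda>q. A ** L q)) \<and>
     (\<forall>p\<in>M. levi_nondegenerate s M p)"

definition GL :: "(complex^'n^'n) monoid" where
  "GL = \<lparr>carrier = {A. invertible A}, mult = (**), one = mat 1\<rparr>"

definition closed_subgroup_GL :: "(complex^'n^'n) set \<Rightarrow> bool" where
  "closed_subgroup_GL G \<longleftrightarrow> subgroup G GL \<and> closedin (top_of_set (carrier GL)) G"

definition frames_reduce_to :: "smoothness \<Rightarrow> (complex^3) set \<Rightarrow> (complex^5^5) set \<Rightarrow> bool" where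
  "frames_reduce_to s M G \<longleftrightarrow>
     closed_subgroup_GL G \<and>
     (\<forall>V L L'. admissible s M V L \<and> admissible s M V L' \<longrightarrow>
        (\<exists>g. \<forall>p\<in>V. g p \<in> G \<and> assoc_frame M L' p = g p ** assoc_frame M L p))"

definition G_IV_1_initial :: "(complex^5^5) set" where
  "G_IV_1_initial =
     {vector [vector [a11, a21, 0, 0, 0],
              vector [a12, a22, 0, 0, 0],
              vector [0, 0, cnj a11, cnj a21, 0],
              vector [0, 0, cnj a12, cnj a22, 0],
              vector [b1, b2, cnj b1, cnj b2, complex_of_real c]]
      | a11 a12 a21 a22 b1 b2 c. c \<noteq> 0 \<and> a11 * a22 - a12 * a21 \<noteq> 0}"

end

(* At each point both associated frames are bases of the complexified tangent space, and the
   two pairs of generators are bases of T10. The transition matrix g therefore exists, is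
   invertible, and its first four rows come from the transition matrix of the generators and its
   conjugate. The bracket i [L1, conj L1] is a real vector field, so uniqueness of coefficients
   gives the last row the shape (b1, b2, cnj b1, cnj b2, c) with c real, and invertibility of g
   gives c \<noteq> 0. The structure group is the intersection of the open set of invertible matrices
   with a real-linear subspace of dimension 13; this makes it closed in GL and a submanifold. *)
theory Submission
  imports Defs
begin

section \<open>Five-dimensional vectors\<close>

lemma exhaust_5:
  fixes x :: 5
  shows "x = 1 \<or> x = 2 \<or> x = 3 \<or> x = 4 \<or> x = 5"
proof (induct x)
  case (of_int z)
  \<comment> \<open>The representatives run from 0 to 4, and 0 is the index 5.\<close>
  then have "z = 0 \<or> z = 1 \<or> z = 2 \<or> z = 3 \<or> z = 4" by fastforce
  then show ?case by auto
qed

lemma forall_5: "(\<forall>i::5. P i) \<longleftrightarrow> P 1 \<and> P 2 \<and> P 3 \<and> P 4 \<and> P 5"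
  by (metis exhaust_5)

lemma UNIV_5: "UNIV = {1, 2, 3, 4, 5::5}"
  using exhaust_5 by auto

lemma sum_5: "sum f (UNIV::5 set) = f 1 + f 2 + f 3 + f 4 + f 5"
  unfolding UNIV_5 by (simp add: ac_simps)

lemma vector_5 [simp]:
  "(vector [v, w, x, y, z] :: ('a::zero)^5) $ 1 = v"
  "(vector [v, w, x, y, z] :: ('a::zero)^5) $ 2 = w"
  "(vector [v, w, x, y, z] :: ('a::zero)^5) $ 3 = x"
  "(vector [v, w, x, y, z] :: ('a::zero)^5) $ 4 = y"
  "(vector [v, w, x, y, z] :: ('a::zero)^5) $ 5 = z"
  unfolding vector_def by simp_all

section \<open>The structure group\<close>

definition G_mat ::
  "complex \<Rightarrow> complex \<Rightarrow> complex \<Rightarrow> complex \<Rightarrow> complex \<Rightarrow> complex \<Rightarrow> real \<Rightarrow> complex^5^5" where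
  "G_mat a11 a12 a21 a22 b1 b2 c =
     vector [vector [a11, a21, 0, 0, 0],
             vector [a12, a22, 0, 0, 0],
             vector [0, 0, cnj a11, cnj a21, 0],
             vector [0, 0, cnj a12, cnj a22, 0],
             vector [b1, b2, cnj b1, cnj b2, complex_of_real c]]"

lemma G_IV_1_initial_altdef:
  "G_IV_1_initial =
     {G_mat a11 a12 a21 a22 b1 b2 c | a11 a12 a21 a22 b1 b2 c.
        c \<noteq> 0 \<and> a11 * a22 - a12 * a21 \<noteq> 0}"
  unfolding G_IV_1_initial_def G_mat_def ..

lemma G_mat_mult:
  "G_mat a11 a12 a21 a22 b1 b2 c ** G_mat a11' a12' a21' a22' b1' b2' c' =
     G_mat (a11 * a11' + a21 * a12') (a12 * a11' + a22 * a12')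
           (a11 * a21' + a21 * a22') (a12 * a21' + a22 * a22')
           (b1 * a11' + b2 * a12' + c * b1') (b1 * a21' + b2 * a22' + c * b2') (c * c')"
  by (simp add: G_mat_def vec_eq_iff forall_5 matrix_matrix_mult_def sum_5)

lemma G_mat_one: "G_mat 1 0 0 1 0 0 1 = mat 1"
  by (simp add: G_mat_def vec_eq_iff forall_5 mat_def)

lemma G_IV_1_initialE:
  assumes "A \<in> G_IV_1_initial"
  obtains a11 a12 a21 a22 b1 b2 c where "A = G_mat a11 a12 a21 a22 b1 b2 c"
    "c \<noteq> 0" "a11 * a22 - a12 * a21 \<noteq> 0"
  using assms unfolding G_IV_1_initial_altdef by blast

lemma G_mat_right_inverse:
  assumes "c \<noteq> 0" and "a11 * a22 - a12 * a21 \<noteq> 0"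
  shows "\<exists>B\<in>G_IV_1_initial. G_mat a11 a12 a21 a22 b1 b2 c ** B = mat 1"
proof -
  define d where "d = a11 * a22 - a12 * a21"
  \<comment> \<open>The upper block is inverted by Cramer's rule; the new last row then solves
    \<open>b A' + c b' = 0\<close>, where \<open>A'\<close> is that inverse.\<close>
  define B where "B = G_mat (a22 / d) (- a12 / d) (- a21 / d) (a11 / d)
    ((- b1 * a22 + b2 * a12) / (c * d)) ((b1 * a21 - b2 * a11) / (c * d)) (1 / c)"
  have d: "d \<noteq> 0" and c: "complex_of_real c \<noteq> 0" using assms by (simp_all add: d_def)
  have det: "a22 / d * (a11 / d) - (- a12 / d) * (- a21 / d) = 1 / d"
  proof -
    have "a22 / d * (a11 / d) - (- a12 / d) * (- a21 / d) = (a11 * a22 - a12 * a21) / (d * d)"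
      using d by (simp add: field_simps)
    then show ?thesis using d by (simp flip: d_def)
  qed
  have "B \<in> G_IV_1_initial"
    unfolding G_IV_1_initial_altdef B_def using assms(1) d det by fastforce
  moreover have "a11 * (a22 / d) + a21 * (- a12 / d) = 1" "a12 * (a22 / d) + a22 * (- a12 / d) = 0"
    "a11 * (- a21 / d) + a21 * (a11 / d) = 0" "a12 * (- a21 / d) + a22 * (a11 / d) = 1"
    "b1 * (a22 / d) + b2 * (- a12 / d) + c * ((- b1 * a22 + b2 * a12) / (c * d)) = 0"
    "b1 * (- a21 / d) + b2 * (a11 / d) + c * ((b1 * a21 - b2 * a11) / (c * d)) = 0"
    "c * (1 / c) = 1"
    using d c by (simp_all add: field_simps) (simp_all add: d_def algebra_simps)
  then have "G_mat a11 a12 a21 a22 b1 b2 c ** B = G_mat 1 0 0 1 0 0 1"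
    unfolding B_def G_mat_mult by (simp only:)
  ultimately show ?thesis by (auto simp: G_mat_one)
qed

lemma invertible_G_mat_iff:
  "invertible (G_mat a11 a12 a21 a22 b1 b2 c) \<longleftrightarrow> c \<noteq> 0 \<and> a11 * a22 - a12 * a21 \<noteq> 0"
proof
  assume "invertible (G_mat a11 a12 a21 a22 b1 b2 c)"
  then obtain B where B: "G_mat a11 a12 a21 a22 b1 b2 c ** B = mat 1"
      "B ** G_mat a11 a12 a21 a22 b1 b2 c = mat 1"
    unfolding invertible_def by blast
  \<comment> \<open>The only nonzero entry in the last column of the matrix is
    \<open>c\<close>.\<close>
  have "B $ 5 $ 5 * complex_of_real c = 1"
    using arg_cong[OF B(2), of "\<lambda>X. X $ 5 $ 5"]
    by (simp add: G_mat_def matrix_matrix_mult_def sum_5 mat_def)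
  moreover have "a11 * B$1$1 + a21 * B$2$1 = 1" "a11 * B$1$2 + a21 * B$2$2 = 0"
      "a12 * B$1$1 + a22 * B$2$1 = 0" "a12 * B$1$2 + a22 * B$2$2 = 1"
    using arg_cong[OF B(1), of "\<lambda>X. X $ 1 $ 1"] arg_cong[OF B(1), of "\<lambda>X. X $ 1 $ 2"]
      arg_cong[OF B(1), of "\<lambda>X. X $ 2 $ 1"] arg_cong[OF B(1), of "\<lambda>X. X $ 2 $ 2"]
    by (simp_all add: G_mat_def matrix_matrix_mult_def sum_5 mat_def)
  \<comment> \<open>The first two rows vanish outside the upper left block, so that block of the
    product is a product of 2 by 2 matrices; determinants multiply.\<close>
  then have "(a11 * a22 - a12 * a21) * (B$1$1 * B$2$2 - B$1$2 * B$2$1) = 1"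
    by algebra
  ultimately show "c \<noteq> 0 \<and> a11 * a22 - a12 * a21 \<noteq> 0" by auto
next
  assume "c \<noteq> 0 \<and> a11 * a22 - a12 * a21 \<noteq> 0"
  then show "invertible (G_mat a11 a12 a21 a22 b1 b2 c)"
    using G_mat_right_inverse unfolding invertible_right_inverse by blast
qed

section \<open>Linear parametrisation and real dimension\<close>

definition G_param ::
  "complex \<times> complex \<times> complex \<times> complex \<times> complex \<times> complex \<times> real \<Rightarrow> complex^5^5" where
  "G_param = (\<lambda>(a11, a12, a21, a22, b1, b2, c). G_mat a11 a12 a21 a22 b1 b2 c)"

text \<open>Linearity holds over the reals only, because of the conjugated entries.\<close>

lemma linear_G_param: "linear G_param"
  by (rule linearI)
     (auto simp: G_param_def G_mat_def vec_eq_iff forall_5 complex_eq_iff)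

lemma inj_G_param: "inj G_param"
  by (auto simp: inj_def G_param_def G_mat_def vec_eq_iff forall_5)

lemma subspace_range_G_param: "subspace (range G_param)"
  by (intro linear_subspace_image linear_G_param subspace_UNIV)

text \<open>Six complex parameters and a real one count 6 * 2 + 1 over the reals.\<close>

lemma dim_range_G_param: "dim (range G_param) = 13"
  using dim_image_eq[OF linear_G_param, of UNIV] inj_G_param by simp

text \<open>Separates an open condition from a linear one; closedness in \<open>GL\<close> and the
  manifold structure both follow from this splitting.\<close>

lemma G_IV_1_initial_eq_invertible:
  "G_IV_1_initial = {A. invertible A} \<inter> range G_param"
proof -
  have "A \<in> range G_param \<longleftrightarrow> (\<exists>a11 a12 a21 a22 b1 b2 c. A = G_mat a11 a12 a21 a22 b1 b2 c)" for A
    by (simp add: image_iff G_param_def split_paired_Ex)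
  then have "A \<in> G_IV_1_initial \<longleftrightarrow> invertible A \<and> A \<in> range G_param" for A
    unfolding G_IV_1_initial_altdef mem_Collect_eq by (metis invertible_G_mat_iff)
  then show ?thesis by blast
qed

lemma G_mat_in_G_IV_1_initial_iff:
  "G_mat a11 a12 a21 a22 b1 b2 c \<in> G_IV_1_initial \<longleftrightarrow> c \<noteq> 0 \<and> a11 * a22 - a12 * a21 \<noteq> 0"
proof -
  have "G_mat a11 a12 a21 a22 b1 b2 c = G_param (a11, a12, a21, a22, b1, b2, c)"
    by (simp add: G_param_def)
  then have "G_mat a11 a12 a21 a22 b1 b2 c \<in> range G_param" by (metis rangeI)
  then show ?thesis by (simp add: G_IV_1_initial_eq_invertible invertible_G_mat_iff)
qed

section \<open>Closed subgroup of the general linear group\<close>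

lemma group_GL: "group (GL :: (complex^'n^'n) monoid)"
proof (rule groupI)
  fix x :: "complex^'n^'n" assume "x \<in> carrier GL"
  then show "\<exists>y\<in>carrier GL. y \<otimes>\<^bsub>GL\<^esub> x = \<one>\<^bsub>GL\<^esub>"
    by (auto simp: GL_def invertible_def)
next
  have "invertible (mat 1 :: complex^'n^'n)"
    by (simp add: invertible_det_nz)
  then show "\<one>\<^bsub>GL\<^esub> \<in> carrier (GL :: (complex^'n^'n) monoid)"
    by (simp add: GL_def)
qed (auto simp: GL_def invertible_mult matrix_mul_assoc)

lemma subgroup_G_IV_1_initial: "subgroup G_IV_1_initial GL"
proof -
  interpret group "GL :: (complex^5^5) monoid" by (rule group_GL)
  show ?thesis
  proof (rule subgroupI)
    show "G_IV_1_initial \<subseteq> carrier GL"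
      by (auto simp: G_IV_1_initial_eq_invertible GL_def)
    show "G_IV_1_initial \<noteq> {}"
      using G_mat_in_G_IV_1_initial_iff[of 1 0 0 1 0 0 1] by auto
  next
    fix A assume A: "A \<in> G_IV_1_initial"
    then have "A \<in> carrier GL"
      by (auto simp: G_IV_1_initial_eq_invertible GL_def)
    obtain B where B: "B \<in> G_IV_1_initial" "A ** B = mat 1"
      using A by (metis G_IV_1_initialE G_mat_right_inverse)
    then have "inv\<^bsub>GL\<^esub> A = B"
      using matrix_left_right_inverse[of A B] \<open>A \<in> carrier GL\<close>
      by (intro inv_equality) (auto simp: GL_def G_IV_1_initial_eq_invertible)
    then show "inv\<^bsub>GL\<^esub> A \<in> G_IV_1_initial" using B by simp
  next
    fix A B assume AB: "A \<in> G_IV_1_initial" "B \<in> G_IV_1_initial"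
    \<comment> \<open>The product keeps the matrix shape, and its invertibility supplies the
      nonvanishing conditions.\<close>
    then have "invertible (A ** B)"
      by (auto simp: G_IV_1_initial_eq_invertible invertible_mult)
    moreover from AB have "\<exists>a11 a12 a21 a22 b1 b2 c. A ** B = G_mat a11 a12 a21 a22 b1 b2 c"
      by (metis G_IV_1_initialE G_mat_mult)
    ultimately show "A \<otimes>\<^bsub>GL\<^esub> B \<in> G_IV_1_initial"
      by (auto simp: GL_def G_mat_in_G_IV_1_initial_iff invertible_G_mat_iff)
  qed
qed

text \<open>A linear subspace of a finite-dimensional space is closed, so its trace on
  \<open>GL\<close> is relatively closed.\<close>

lemma closed_subgroup_G_IV_1_initial: "closed_subgroup_GL G_IV_1_initial"
  unfolding closed_subgroup_GL_def closedin_closed G_IV_1_initial_eq_invertible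
  using subgroup_G_IV_1_initial closed_subspace[OF subspace_range_G_param]
  by (auto simp: GL_def G_IV_1_initial_eq_invertible)

section \<open>Manifold structure of the group\<close>

lemma Ck_on_const: "Ck_on k U (\<lambda>x. c)"
  by (induction k arbitrary: c) auto

lemma Ck_on_id: "Ck_on k U (\<lambda>x. x)"
  by (cases k) (auto simp: Ck_on_const)

text \<open>The identity of \<open>U\<close> is a global flattening chart with model subspace
  \<open>W\<close>.\<close>

lemma embedded_submanifold_open_subspace:
  fixes W :: "'a::euclidean_space set"
  assumes "open U" "subspace W"
  shows "embedded_submanifold C_infinity (dim W) (U \<inter> W)"
  unfolding embedded_submanifold_def
proof
  fix p assume "p \<in> U \<inter> W"
  moreover have "homeomorphism U U (\<lambda>x. x) (\<lambda>x. x)"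
    by (simp add: homeomorphism_def)
  ultimately show "\<exists>U' U'' \<phi> \<psi> (W' :: 'a set).
        open U' \<and> p \<in> U' \<and> open U'' \<and> homeomorphism U' U'' \<phi> \<psi> \<and>
        of_class_on C_infinity U' \<phi> \<and> of_class_on C_infinity U'' \<psi> \<and>
        subspace W' \<and> dim W' = dim W \<and> \<phi> ` (U' \<inter> (U \<inter> W)) = U'' \<inter> W'"
    using assms
    by (intro exI[of _ U] exI[of _ "\<lambda>x. x"] exI[of _ W]) (auto simp: Ck_on_id)
qed

lemma open_invertible: "open {A :: complex^'n^'n. invertible A}"
proof -
  have "continuous_on UNIV (det :: complex^'n^'n \<Rightarrow> complex)"
    unfolding det_def by (intro continuous_intros)
  then show ?thesis
    unfolding invertible_det_nz
    by (intro open_Collect_neq) auto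
qed

lemma embedded_submanifold_G_IV_1_initial:
  "embedded_submanifold C_infinity 13 G_IV_1_initial"
  using embedded_submanifold_open_subspace[OF open_invertible subspace_range_G_param]
  by (simp add: G_IV_1_initial_eq_invertible dim_range_G_param)

section \<open>Frames as bases\<close>

text \<open>Since frames are stored as rows, left multiplication forms linear combinations of frame
  vectors.\<close>

lemma row_matrix_matrix_mult:
  fixes A :: "'a::semiring_1^'k^'m" and F :: "'a^'n^'k"
  shows "(A ** F) $ i = (\<Sum>k\<in>UNIV. A $ i $ k *s F $ k)"
  by (simp add: vec_eq_iff matrix_matrix_mult_def sum_component)

lemma is_basis_expansion:
  fixes F :: "ctvec^'n"
  assumes "is_basis F W" "v \<in> W"
  shows "\<exists>c. v = (\<Sum>i\<in>UNIV. c $ i *s F $ i)"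
proof -
  have inj: "inj (($) F)" and "v \<in> vec.span (range (($) F))"
    using assms unfolding is_basis_def by auto
  then obtain u where "v = (\<Sum>w\<in>range (($) F). u w *s w)"
    by (auto simp: vec.span_finite)
  also have "\<dots> = (\<Sum>i\<in>UNIV. (\<chi> i. u (F $ i)) $ i *s F $ i)"
    by (simp add: sum.reindex[OF inj])
  finally show ?thesis ..
qed

lemma is_basis_unique:
  fixes F :: "ctvec^'n" and c d :: "complex^'n"
  assumes F: "is_basis F W" and eq: "(\<Sum>i\<in>UNIV. c $ i *s F $ i) = (\<Sum>i\<in>UNIV. d $ i *s F $ i)"
  shows "c = d"
proof -
  have inj: "inj (($) F)" and ind: "vec.independent (range (($) F))"
    using F unfolding is_basis_def by auto
  \<comment> \<open>Independence speaks of coefficients indexed by vectors; injectivity of the frame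
    lets them be indexed by position.\<close>
  let ?u = "\<lambda>w. (c - d) $ inv_into UNIV (($) F) w"
  have "(\<Sum>w\<in>range (($) F). ?u w *s w) = (\<Sum>i\<in>UNIV. (c - d) $ i *s F $ i)"
    by (simp add: sum.reindex[OF inj] inv_f_f[OF inj])
  also have "\<dots> = 0"
    using eq by (simp add: vector_sub_rdistrib sum_subtractf)
  finally have "?u (F $ i) = 0" for i
    by (intro vec.independentD[OF ind, of "range (($) F)" ?u]) auto
  then show ?thesis by (simp add: vec_eq_iff inv_f_f[OF inj])
qed

lemma is_basis_transition:
  fixes F :: "ctvec^'n" and F' :: "ctvec^'m"
  assumes "is_basis F W" "\<And>i. F' $ i \<in> W"
  shows "\<exists>g. F' = g ** F"
proof -
  have "\<forall>i. \<exists>c. F' $ i = (\<Sum>k\<in>UNIV. c $ k *s F $ k)"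
    using is_basis_expansion[OF assms(1)] assms(2) by blast
  then obtain c where "\<forall>i. F' $ i = (\<Sum>k\<in>UNIV. c i $ k *s F $ k)"
    unfolding choice_iff by blast
  then have "F' $ i = ((\<chi> i. c i) ** F) $ i" for i
    by (simp add: row_matrix_matrix_mult)
  then have "F' = (\<chi> i. c i) ** F"
    unfolding vec_eq_iff[of F'] by blast
  then show ?thesis ..
qed

lemma is_basis_in: "is_basis F W \<Longrightarrow> F $ i \<in> W"
  unfolding is_basis_def by (metis rangeI vec.span_base)

text \<open>Going to \<open>F'\<close> and back fixes \<open>F\<close>, so uniqueness of
  coefficients makes the return matrix a left inverse.\<close>

lemma is_basis_transition_invertible:
  fixes F F' :: "ctvec^'n"
  assumes "is_basis F W" "is_basis F' W" "F' = g ** F"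
  shows "invertible g"
proof -
  obtain h where "F = h ** F'"
    using is_basis_transition[OF assms(2)] is_basis_in[OF assms(1)] by metis
  then have *: "(h ** g) ** F = mat 1 ** F"
    using assms(3) by (simp add: matrix_mul_assoc)
  have "(h ** g) $ i = mat 1 $ i" for i
    by (rule is_basis_unique[OF assms(1)]) (use * in \<open>simp flip: row_matrix_matrix_mult\<close>)
  then show ?thesis
    unfolding invertible_left_inverse by (auto simp: vec_eq_iff)
qed

section \<open>Conjugation and the Lie bracket\<close>

lemma conj_vec_component [simp]: "conj_vec X $ k = cnj (X $ k)"
  by (simp add: conj_vec_def)

lemma conj_vec_conj_vec [simp]: "conj_vec (conj_vec X) = X"
  by (simp add: vec_eq_iff)

lemma conj_vec_add: "conj_vec (X + Y) = conj_vec X + conj_vec Y"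
  by (simp add: vec_eq_iff)

lemma conj_vec_scale: "conj_vec (c *s X) = cnj c *s conj_vec X"
  by (simp add: vec_eq_iff)

lemma re_part_conj_vec: "re_part (conj_vec X) = re_part X"
  by (simp add: re_part_def)

lemma im_part_conj_vec: "im_part (conj_vec X) = - im_part X"
  by (simp add: im_part_def vec_eq_iff complex_eq_iff)

text \<open>Off the tangent space a derivative within \<open>M\<close> is not unique, so
  \<^const>\<open>frechet_derivative\<close>, being a choice, commutes with conjugation only on tangent vectors.\<close>

lemma has_derivative_unique_tangent:
  assumes "(f has_derivative f') (at p within M)" "(f has_derivative f'') (at p within M)"
    and "v \<in> tangent_space M p"
  shows "f' v = f'' v"
proof -
  obtain \<gamma> where \<gamma>: "\<gamma> 0 = p" "\<And>t. \<gamma> t \<in> M" "(\<gamma> has_vector_derivative v) (at (0::real))"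
    using assms(3) unfolding tangent_space_def by auto
  \<comment> \<open>By the chain rule, any derivative \<open>D\<close> within \<open>M\<close> sends
    \<open>v\<close> to the derivative of \<open>f\<close> along the curve, which is unique.\<close>
  have "((f \<circ> \<gamma>) has_vector_derivative D v) (at 0)" if D: "(f has_derivative D) (at p within M)" for D
  proof -
    have "(f has_derivative D) (at (\<gamma> 0) within range \<gamma>)"
      using D \<gamma> by (auto intro: has_derivative_subset)
    then have "((f \<circ> \<gamma>) has_derivative D \<circ> (\<lambda>t. t *\<^sub>R v)) (at 0)"
      using \<gamma>(3) unfolding has_vector_derivative_def by (intro diff_chain_within) auto
    moreover have "D \<circ> (\<lambda>t. t *\<^sub>R v) = (\<lambda>t. t *\<^sub>R D v)"
      using has_derivative_linear[OF D] by (auto simp: linear_scale)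
    ultimately show ?thesis by (simp add: has_vector_derivative_def)
  qed
  from this[OF assms(1)] this[OF assms(2)] show ?thesis
    by (rule vector_derivative_unique_at)
qed

text \<open>Conjugation fixes the real part of \<open>X\<close> and negates both the imaginary part
  and the factor \<open>\<i>\<close>.\<close>

lemma cnj_derive_along:
  assumes f: "f differentiable (at p within M)" and X: "X \<in> CT M p"
  shows "cnj (derive_along M X f p) = derive_along M (conj_vec X) (\<lambda>q. cnj (f q)) p"
proof -
  let ?D = "frechet_derivative f (at p within M)"
    and ?D' = "frechet_derivative (\<lambda>q. cnj (f q)) (at p within M)"
  have D: "(f has_derivative ?D) (at p within M)"
    using f by (simp add: frechet_derivative_works)
  then have D1: "((\<lambda>q. cnj (f q)) has_derivative (\<lambda>v. cnj (?D v))) (at p within M)"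
    by (rule has_derivative_cnj)
  then have D': "((\<lambda>q. cnj (f q)) has_derivative ?D') (at p within M)"
    using differentiableI frechet_derivative_works by blast
  have "?D' v = cnj (?D v)" if "v \<in> tangent_space M p" for v
    using has_derivative_unique_tangent[OF D' D1 that] .
  then show ?thesis
    using X linear_neg[OF has_derivative_linear[OF D']]
    by (simp add: derive_along_def CT_def re_part_conj_vec im_part_conj_vec)
qed

text \<open>Conjugating swaps the two arguments of the bracket and so reverses its sign; the
  conjugate of \<open>\<i>\<close> cancels that sign.\<close>

lemma conj_vec_ii_lie_bracket:
  fixes X :: "complex^3 \<Rightarrow> ctvec"
  assumes X: "X differentiable (at p within M)" and "X p \<in> CT M p" "conj_vec (X p) \<in> CT M p"
  shows "conj_vec (\<i> *s lie_bracket M X (\<lambda>q. conj_vec (X q)) p) =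
         \<i> *s lie_bracket M X (\<lambda>q. conj_vec (X q)) p"
proof -
  have d: "(\<lambda>q. X q $ k) differentiable (at p within M)" for k
    using X unfolding differentiable_def
    by (blast intro: bounded_linear.has_derivative[OF bounded_linear_vec_nth])
  then have "(\<lambda>q. cnj (X q $ k)) differentiable (at p within M)" for k
    unfolding differentiable_def by (metis has_derivative_cnj)
  with d assms(2,3) show ?thesis
    by (simp add: vec_eq_iff lie_bracket_def cnj_derive_along algebra_simps)
qed

text \<open>The bundle class is at least \<open>C_fin 2\<close>, so a local extension of
  \<open>L\<close> is differentiable at \<open>p\<close>.\<close>

lemma local_generators_differentiable:
  assumes s: "(\<exists>\<kappa>\<ge>3. s = C_fin \<kappa>) \<or> s = C_infinity \<or> s = C_omega"
    and L: "local_generators s M V L" and p: "p \<in> V"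
  shows "L differentiable (at p within M)"
proof -
  obtain U F where U: "open U" "p \<in> U" "of_class_on (bundle_class s) U F"
    and F: "\<And>x. x \<in> U \<inter> V \<Longrightarrow> F x = L x"
    using L p unfolding local_generators_def of_class_on_sub_def by blast
  obtain T where T: "open T" "V = M \<inter> T"
    using L unfolding local_generators_def openin_open by auto
  have "\<exists>k. Ck_on (Suc k) U F"
    using s
  proof (elim disjE exE conjE)
    fix \<kappa> assume "(3::nat) \<le> \<kappa>" "s = C_fin \<kappa>"
    moreover from this have "\<kappa> - 1 = Suc (\<kappa> - 2)" by simp
    ultimately show ?thesis using U(3) by (intro exI[of _ "\<kappa> - 2"]) (simp del: Ck_on.simps)
  qed (use U(3) in auto)
  then have "F differentiable (at p)" using U(2) by auto
  then have "F differentiable (at p within M)"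
    by (rule differentiable_at_withinI)
  moreover have "\<forall>\<^sub>F x in at p within M. F x = L x"
    unfolding eventually_at_topological using U T F p
    \<comment> \<open>Points of \<open>M\<close> in \<open>T\<close> lie in \<open>V\<close>, where
      the extension agrees with \<open>L\<close>.\<close>
    by (intro exI[of _ "U \<inter> T"]) auto
  ultimately show ?thesis
    unfolding differentiable_def using U(2) T(2) F p
    by (auto intro: has_derivative_transform_eventually)
qed

section \<open>Change of admissible frame\<close>

lemma conj_assoc_frame_component:
  "assoc_frame M L p $ 3 = conj_vec (assoc_frame M L p $ 1)"
  "assoc_frame M L p $ 4 = conj_vec (assoc_frame M L p $ 2)"
  by (simp_all add: assoc_frame_def)

lemma conj_assoc_frame_5:
  assumes s: "(\<exists>\<kappa>\<ge>3. s = C_fin \<kappa>) \<or> s = C_infinity \<or> s = C_omega"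
    and L: "admissible s M V L" and p: "p \<in> V"
  shows "conj_vec (assoc_frame M L p $ 5) = assoc_frame M L p $ 5"
proof -
  have gen: "local_generators s M V L" and "is_basis (assoc_frame M L p) (CT M p)"
    using L p unfolding admissible_def by auto
  \<comment> \<open>Tangency of the first generator and its conjugate is read off from their
    membership in the basis.\<close>
  then have "assoc_frame M L p $ 1 \<in> CT M p" "assoc_frame M L p $ 3 \<in> CT M p"
    by (auto intro: is_basis_in)
  moreover have "(\<lambda>q. L q $ 1) differentiable (at p within M)"
    using local_generators_differentiable[OF s gen p]
    unfolding differentiable_def
    by (blast intro: bounded_linear.has_derivative[OF bounded_linear_vec_nth])
  ultimately show ?thesis
    using conj_vec_ii_lie_bracket[of "\<lambda>q. L q $ 1" p M] by (simp add: assoc_frame_def)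
qed

lemma admissible_frame_change:
  assumes s: "(\<exists>\<kappa>\<ge>3. s = C_fin \<kappa>) \<or> s = C_infinity \<or> s = C_omega"
    and L: "admissible s M V L" and L': "admissible s M V L'" and p: "p \<in> V"
  shows "\<exists>g\<in>G_IV_1_initial. assoc_frame M L' p = g ** assoc_frame M L p"
proof -
  let ?F = "assoc_frame M L p" and ?F' = "assoc_frame M L' p"
  have bas: "is_basis (L p) (T10 M p)" "is_basis ?F (CT M p)"
      "is_basis (L' p) (T10 M p)" "is_basis ?F' (CT M p)"
    using L L' p unfolding admissible_def local_generators_def by auto
  obtain a where a: "L' p = a ** L p"
    using is_basis_transition[OF bas(1)] is_basis_in[OF bas(3)] by metis
  have F'12: "?F' $ 1 = a$1$1 *s ?F$1 + a$1$2 *s ?F$2" "?F' $ 2 = a$2$1 *s ?F$1 + a$2$2 *s ?F$2"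
    by (simp_all add: assoc_frame_def a row_matrix_matrix_mult sum_2)
  obtain b where b: "?F' $ 5 = (\<Sum>i\<in>UNIV. b $ i *s ?F $ i)"
    using is_basis_expansion[OF bas(2) is_basis_in[OF bas(4)]] by blast
  have conj5: "conj_vec (?F $ 5) = ?F $ 5" "conj_vec (?F' $ 5) = ?F' $ 5"
    using conj_assoc_frame_5[OF s _ p] L L' by auto
  \<comment> \<open>Conjugation exchanges frame vectors 1 and 3, and 2 and 4, and fixes the fifth,
    so the conjugated coefficients are permuted accordingly.\<close>
  have "(\<Sum>i\<in>UNIV. vector [cnj (b$3), cnj (b$4), cnj (b$1), cnj (b$2), cnj (b$5)] $ i *s ?F $ i)
      = conj_vec (?F' $ 5)"
    by (simp add: b sum_5 conj_vec_add conj_vec_scale conj_assoc_frame_component conj5 ac_simps)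
  also have "\<dots> = (\<Sum>i\<in>UNIV. b $ i *s ?F $ i)"
    by (simp only: conj5(2)) (rule b)
  finally have b_eq: "vector [cnj (b$3), cnj (b$4), cnj (b$1), cnj (b$2), cnj (b$5)] = b"
    by (rule is_basis_unique[OF bas(2)])
  have "cnj (b$1) = b$3" "cnj (b$2) = b$4" "cnj (b$5) = b$5"
    using arg_cong[OF b_eq, of "\<lambda>x. x $ 3"] arg_cong[OF b_eq, of "\<lambda>x. x $ 4"]
      arg_cong[OF b_eq, of "\<lambda>x. x $ 5"] by (simp_all only: vector_5)
  then have real: "b$3 = cnj (b$1)" "b$4 = cnj (b$2)" "complex_of_real (Re (b$5)) = b$5"
    by (simp_all add: complex_eq_iff)
  \<comment> \<open>\<open>G_mat\<close> takes its block entries column by column, hence the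
    transposed order of the entries of \<open>a\<close>.\<close>
  define g where "g = G_mat (a$1$1) (a$2$1) (a$1$2) (a$2$2) (b$1) (b$2) (Re (b$5))"
  have "\<forall>i. ?F' $ i = (g ** ?F) $ i"
    unfolding forall_5 row_matrix_matrix_mult sum_5
    using real by (simp add: g_def G_mat_def F'12 b sum_5
        conj_assoc_frame_component conj_vec_add conj_vec_scale)
  then have "?F' = g ** ?F"
    unfolding vec_eq_iff[of ?F'] .
  \<comment> \<open>Invertibility yields \<open>c \<noteq> 0\<close> and the nonzero block
    determinant without computing the bracket of the new generators.\<close>
  moreover from is_basis_transition_invertible[OF bas(2,4) this] have "g \<in> G_IV_1_initial"
    by (simp add: g_def G_mat_in_G_IV_1_initial_iff invertible_G_mat_iff)
  ultimately show ?thesis by blast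
qed

theorem mainTheorem5:
  fixes M :: "(complex^3) set" and s :: smoothness
  assumes "(\<exists>\<kappa>\<ge>3. s = C_fin \<kappa>) \<or> s = C_infinity \<or> s = C_omega"
    and "real_hypersurface s M"
    and "connected M"
    and "class_IV_1 s M"
  shows "frames_reduce_to s M G_IV_1_initial \<and>
         embedded_submanifold C_infinity 13 G_IV_1_initial"
  unfolding frames_reduce_to_def
  using closed_subgroup_G_IV_1_initial embedded_submanifold_G_IV_1_initial
    admissible_frame_change[OF assms(1)]
  \<comment> \<open>Choice assembles the pointwise matrices into a function on
    \<open>V\<close>.\<close>
  by (auto simp: Bex_def intro!: bchoice)

end
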